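(* Let $I$ be an open interval in $\mathbb{R}$. If $f:I\to\mathbb{R}$ is convex, then $f\in S^1(I)$ and $f^{\mathrm{sd}}(x)\in\partial f(x)$ for every $x\in I$; equivalently, $$f(y) \geq f(x)+f^{\mathrm{sd}}(x)(y-x)$$ for all $x, y\in I$.
   Context: For an open interval $I\subset\mathbb{R}$, a function $f:I\to\mathbb{R}$ and a point $x\in I$, the specular derivative of $f$ at $x$ is $$f^{\mathrm{sd}}(x) := \lim_{h \searrow 0} \mathcal{A}(f(x + h) - f(x), f(x) - f(x - h), h)$$ (with $h>0$ small enough that $x\pm h\in I$), where $\mathcal{A}:\mathbb{R}\times\mathbb{R}\times(0,\infty)\to\mathbb{R}$ is $$\mathcal{A}(a, b, c) := \frac{a \sqrt{b^2 + c^2} + b \sqrt{a^2 + c^2}}{c \sqrt{a^2 + c^2} + c \sqrt{b^2 + c^2}}.$$ $f$ is specularly differentiable at $x$ if this limit exists as a finite real number, and specularly differentiable on $I$ if it is so at every point of $I$. $S^0(I)$ is the set of functions $f:I\to\mathbb{R}$ that are specularly differentiable on $I$, and $S^1(I):=C^0(I)\cap S^0(I)$, where $C^0(I)$ is the set of continuous real-valued functions on $I$. Here $\partial f(x)$ denotes the subdifferential of $f$ at $x$ in the sense of convex analysis, i.e. the set of $s\in\mathbb{R}$ with $f(y)\ge f(x)+s(y-x)$ for all $y\in I$. *)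

theory Defs
  imports "HOL-Analysis.Analysis"
begin

text \<open>
  A function on an open interval \<open>I\<close> is represented by a total function \<open>real \<Rightarrow> real\<close> of which
  only the values on \<open>I\<close> matter.  As \<open>I\<close> is open, a one-sided limit \<open>h \<longrightarrow> 0\<close>, \<open>h > 0\<close> at \<open>x \<in> I\<close> only
  sees points \<open>x + h\<close>, \<open>x - h\<close> of \<open>I\<close>, so the specular derivative needs no reference to \<open>I\<close>.
\<close>

text \<open>Meant for \<open>c > 0\<close> only.\<close>

definition specular_A :: "real \<Rightarrow> real \<Rightarrow> real \<Rightarrow> real" where
  "specular_A a b c =
     (a * sqrt (b\<^sup>2 + c\<^sup>2) + b * sqrt (a\<^sup>2 + c\<^sup>2)) /
     (c * sqrt (a\<^sup>2 + c\<^sup>2) + c * sqrt (b\<^sup>2 + c\<^sup>2))"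

definition has_specular_derivative :: "(real \<Rightarrow> real) \<Rightarrow> real \<Rightarrow> real \<Rightarrow> bool" where
  "has_specular_derivative f L x \<longleftrightarrow>
     ((\<lambda>h. specular_A (f (x + h) - f x) (f x - f (x - h)) h) \<longlongrightarrow> L) (at_right 0)"

definition specularly_differentiable :: "(real \<Rightarrow> real) \<Rightarrow> real \<Rightarrow> bool" where
  "specularly_differentiable f x \<longleftrightarrow> (\<exists>L. has_specular_derivative f L x)"

text \<open>Unspecified where the limit does not exist.\<close>

definition specular_deriv :: "(real \<Rightarrow> real) \<Rightarrow> real \<Rightarrow> real" where
  "specular_deriv f x =
     Lim (at_right 0) (\<lambda>h. specular_A (f (x + h) - f x) (f x - f (x - h)) h)"

definition S0 :: "real set \<Rightarrow> (real \<Rightarrow> real) set" where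
  "S0 I = {f. \<forall>x\<in>I. specularly_differentiable f x}"

definition C0 :: "real set \<Rightarrow> (real \<Rightarrow> real) set" where
  "C0 I = {f. continuous_on I f}"

definition S1 :: "real set \<Rightarrow> (real \<Rightarrow> real) set" where
  "S1 I = C0 I \<inter> S0 I"

definition subdifferential :: "real set \<Rightarrow> (real \<Rightarrow> real) \<Rightarrow> real \<Rightarrow> real set" where
  "subdifferential I f x = {s. \<forall>y\<in>I. f y \<ge> f x + s * (y - x)}"

end

theory Submission
  imports Defs
begin

text \<open>
  After division by \<open>h\<close>, the expression whose limit is the specular derivative is a weighted mean of
  the difference quotients \<open>(f (x + h) - f x) / h\<close> and \<open>(f x - f (x - h)) / h\<close>, with positive weights
  that depend continuously on the two quotients (\<open>specular_A_scale\<close>, \<open>specular_A_between\<close>,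
  \<open>tendsto_specular_A_1\<close>).  Hence whenever the one-sided derivatives \<open>l\<close> (left) and \<open>r\<close> (right)
  exist, the specular derivative exists as well and lies between them.

  For a convex function the difference quotient at \<open>x\<close> is monotone in the increment, negative
  increments included.  Each one-sided quotient is therefore monotone and is bounded by any quotient
  from the other side, which gives the existence of \<open>l\<close> and \<open>r\<close> and the inequalities: quotients with
  negative increments are at most \<open>l\<close>, \<open>l \<le> r\<close>, and quotients with positive increments are at least
  \<open>r\<close>.  Every number in \<open>[l, r]\<close>, in particular the specular derivative, is thus a subgradient.
\<close>

section \<open>The specular mean of two slopes\<close>

text \<open>
  Homogeneity of degree 0 under positive scaling turns increments of a function over a step \<open>c\<close> into
  slopes, which have limits where the increments and the step all tend to 0.
\<close>

lemma specular_A_scale: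
  assumes "c > 0"
  shows "specular_A a b c = specular_A (a / c) (b / c) 1"
proof -
  have root: "sqrt (t\<^sup>2 + c\<^sup>2) = c * sqrt ((t / c)\<^sup>2 + 1\<^sup>2)" for t
  proof -
    have "t\<^sup>2 + c\<^sup>2 = c\<^sup>2 * ((t / c)\<^sup>2 + 1\<^sup>2)"
      using assms by (simp add: field_simps)
    then show ?thesis
      using assms by (simp add: real_sqrt_mult)
  qed
  define p where "p = sqrt ((a / c)\<^sup>2 + 1\<^sup>2)"
  define q where "q = sqrt ((b / c)\<^sup>2 + 1\<^sup>2)"
  have "specular_A a b c = (a * (c * q) + b * (c * p)) / (c * (c * p) + c * (c * q))"
    by (simp only: specular_A_def root[of a] root[of b] p_def q_def)
  also have "\<dots> = (a / c * q + b / c * p) / (p + q)"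
  proof -
    have "a * (c * q) + b * (c * p) = (c * c) * (a / c * q + b / c * p)"
      using assms by (simp add: field_simps)
    moreover have "c * (c * p) + c * (c * q) = (c * c) * (p + q)"
      by (simp add: algebra_simps)
    ultimately show ?thesis
      using assms by (simp del: times_divide_eq_left)
  qed
  also have "\<dots> = specular_A (a / c) (b / c) 1"
    by (simp add: specular_A_def p_def q_def)
  finally show ?thesis .
qed

lemma specular_A_between:
  assumes "b \<le> a"
  shows "b \<le> specular_A a b 1" and "specular_A a b 1 \<le> a"
proof -
  define p where "p = sqrt (a\<^sup>2 + 1)"
  define q where "q = sqrt (b\<^sup>2 + 1)"
  have pos: "p > 0" "q > 0"
    by (simp_all add: p_def q_def add_nonneg_pos)
  have A: "specular_A a b 1 = (a * q + b * p) / (p + q)"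
    by (simp add: specular_A_def p_def q_def)
  have "b * q \<le> a * q" "b * p \<le> a * p"
    using assms pos by simp_all
  then show "b \<le> specular_A a b 1" "specular_A a b 1 \<le> a"
    unfolding A using pos by (simp_all add: field_simps)
qed

lemma tendsto_specular_A_1:
  assumes "(u \<longlongrightarrow> a) F" and "(v \<longlongrightarrow> b) F"
  shows "((\<lambda>h. specular_A (u h) (v h) 1) \<longlongrightarrow> specular_A a b 1) F"
proof -
  have "sqrt (a\<^sup>2 + 1) + sqrt (b\<^sup>2 + 1) > 0"
    by (intro add_pos_pos) (simp_all add: add_nonneg_pos)
  then show ?thesis
    unfolding specular_A_def by (auto intro!: tendsto_intros assms)
qed

lemma has_specular_derivative_one_sided:
  assumes "((\<lambda>h. (f (x + h) - f x) / h) \<longlongrightarrow> r) (at_right 0)"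
    and "((\<lambda>h. (f x - f (x - h)) / h) \<longlongrightarrow> l) (at_right 0)"
  shows "has_specular_derivative f (specular_A r l 1) x"
proof -
  have "\<forall>\<^sub>F h in at_right 0. specular_A ((f (x + h) - f x) / h) ((f x - f (x - h)) / h) 1
      = specular_A (f (x + h) - f x) (f x - f (x - h)) h"
    using eventually_at_right_less[of "0::real"]
    by eventually_elim (rule specular_A_scale[symmetric])
  with tendsto_specular_A_1[OF assms] show ?thesis
    unfolding has_specular_derivative_def by (rule Lim_transform_eventually)
qed

lemma specular_deriv_eqI:
  assumes "has_specular_derivative f L x"
  shows "specular_deriv f x = L"
  using assms unfolding has_specular_derivative_def specular_deriv_def
  by (intro tendsto_Lim) simp_all

section \<open>One-sided derivatives of a convex function\<close>

lemma mono_bounded_below_tendsto_at_right_0: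
  fixes g :: "real \<Rightarrow> real"
  assumes "d > 0"
    and mono: "\<And>u v. 0 < u \<Longrightarrow> u < v \<Longrightarrow> v < d \<Longrightarrow> g u \<le> g v"
    and bound: "\<And>u. 0 < u \<Longrightarrow> u < d \<Longrightarrow> m \<le> g u"
  obtains L where "(g \<longlongrightarrow> L) (at_right 0)"
proof
  define L where "L = Inf (g ` {0<..<d})"
  have bdd: "bdd_below (g ` {0<..<d})"
    using bound by (intro bdd_belowI[of _ m]) auto
  have near: "\<forall>\<^sub>F h in at_right 0. h \<in> {0<..<d}"
    using \<open>d > 0\<close> by (rule eventually_at_right_real)
  show "(g \<longlongrightarrow> L) (at_right 0)"
  proof (rule decreasing_tendsto)
    show "\<forall>\<^sub>F h in at_right 0. L \<le> g h"
      using near by eventually_elim (auto simp: L_def intro!: cInf_lower bdd)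
  next
    fix y assume "L < y"
    moreover have "g ` {0<..<d} \<noteq> {}"
      using \<open>d > 0\<close> by simp
    ultimately obtain v where v: "0 < v" "v < d" "g v < y"
      unfolding L_def by (auto simp: cInf_less_iff[OF _ bdd])
    have "\<forall>\<^sub>F h in at_right 0. h \<in> {0<..<v}"
      using \<open>0 < v\<close> by (rule eventually_at_right_real)
    then show "\<forall>\<^sub>F h in at_right 0. g h < y"
      by eventually_elim (use mono v in force)
  qed
qed

text \<open>
  Each sign pattern of the increments is an instance of the three-slope inequality, with \<open>x\<close> as left
  end, middle or right end of the three points.  The middle case makes the left quotients bound the
  right ones.
\<close>

lemma convex_on_difference_quotient_mono:
  fixes f :: "real \<Rightarrow> real"
  assumes f: "convex_on I f" and I: "x \<in> I" "x + u \<in> I" "x + v \<in> I"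
    and uv: "u < v" "u \<noteq> 0" "v \<noteq> 0"
  shows "(f (x + u) - f x) / u \<le> (f (x + v) - f x) / v"
proof -
  consider "0 < u" | "u < 0" "0 < v" | "v < 0"
    using uv by linarith
  then show ?thesis
  proof cases
    case 1
    with convex_on_slope_le(1)[OF f I(1) I(3), of "x + u"] uv show ?thesis
      by (simp add: field_simps)
  next
    case 2
    with convex_on_slope_le[OF f I(2) I(3), of x]
    have "(f (x + u) - f x) / u \<le> (f x - f (x + v)) / (- v)"
      by (simp add: order.trans)
    then show ?thesis
      by (simp add: minus_divide_left)
  next
    case 3
    with convex_on_slope_le(2)[OF f I(2) I(1), of "x + v"] uv show ?thesis
      by simp
  qed
qed

lemma convex_on_one_sided_derivatives:
  fixes f :: "real \<Rightarrow> real"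
  assumes "open I" and f: "convex_on I f" and x: "x \<in> I"
  obtains r l where "((\<lambda>h. (f (x + h) - f x) / h) \<longlongrightarrow> r) (at_right 0)"
    and "((\<lambda>h. (f x - f (x - h)) / h) \<longlongrightarrow> l) (at_right 0)"
    and "l \<le> r"
    and "\<And>h. h < 0 \<Longrightarrow> x + h \<in> I \<Longrightarrow> (f (x + h) - f x) / h \<le> l"
    and "\<And>h. h > 0 \<Longrightarrow> x + h \<in> I \<Longrightarrow> r \<le> (f (x + h) - f x) / h"
proof -
  define D where "D h = (f (x + h) - f x) / h" for h
  have left: "(f x - f (x - h)) / h = D (- h)" for h
    by (simp add: D_def minus_divide_left)
  have D_mono: "D u \<le> D v"
    if "u < v" "u \<noteq> 0" "v \<noteq> 0" "x + u \<in> I" "x + v \<in> I" for u v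
    using convex_on_difference_quotient_mono[OF f x] that by (simp add: D_def)
  obtain d where d: "d > 0" "ball x d \<subseteq> I"
    using openE[OF \<open>open I\<close> x] .
  have I: "x + h \<in> I" if "\<bar>h\<bar> < d" for h
    using d that by (auto simp: dist_real_def)
  have near: "\<forall>\<^sub>F h in at_right 0. h \<in> {0<..<e}" if "e > 0" for e :: real
    using that by (rule eventually_at_right_real)
  obtain r where r: "(D \<longlongrightarrow> r) (at_right 0)"
  proof (rule mono_bounded_below_tendsto_at_right_0)
    show "D (- (d / 2)) \<le> D u" if "0 < u" "u < d" for u
      using d that by (intro D_mono I) auto
  qed (use d in \<open>auto intro!: D_mono I\<close>)
  \<comment> \<open>The left quotients increase as the step shrinks, so their negatives are treated instead.\<close>
  obtain l' where l': "((\<lambda>h. - D (- h)) \<longlongrightarrow> l') (at_right 0)"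
  proof (rule mono_bounded_below_tendsto_at_right_0)
    show "- D (d / 2) \<le> - D (- u)" if "0 < u" "u < d" for u
      using d that by (intro le_imp_neg_le D_mono I) auto
  qed (use d in \<open>auto intro!: D_mono I\<close>)
  define l where "l = - l'"
  have l: "((\<lambda>h. D (- h)) \<longlongrightarrow> l) (at_right 0)"
    using tendsto_minus[OF l'] by (simp add: l_def)
  show thesis
  proof
    show "((\<lambda>h. (f (x + h) - f x) / h) \<longlongrightarrow> r) (at_right 0)"
      using r unfolding D_def .
    show "((\<lambda>h. (f x - f (x - h)) / h) \<longlongrightarrow> l) (at_right 0)"
      using l by (simp add: left)
    show "l \<le> r"
    proof (rule tendsto_le[OF _ r l])
      show "\<forall>\<^sub>F h in at_right 0. D (- h) \<le> D h"
        using near[OF d(1)] by eventually_elim (auto intro!: D_mono I)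
    qed simp
    show "(f (x + h) - f x) / h \<le> l" if "h < 0" "x + h \<in> I" for h
    proof (rule tendsto_lowerbound[OF l])
      have "\<forall>\<^sub>F k in at_right 0. k \<in> {0<..<min d (- h)}"
        using d that by (intro near) simp
      then show "\<forall>\<^sub>F k in at_right 0. (f (x + h) - f x) / h \<le> D (- k)"
        unfolding D_def[symmetric] by eventually_elim (use that in \<open>auto intro!: D_mono I\<close>)
    qed simp
    show "r \<le> (f (x + h) - f x) / h" if "h > 0" "x + h \<in> I" for h
    proof (rule tendsto_upperbound[OF r])
      have "\<forall>\<^sub>F k in at_right 0. k \<in> {0<..<min d h}"
        using d that by (intro near) simp
      then show "\<forall>\<^sub>F k in at_right 0. D k \<le> (f (x + h) - f x) / h"
        unfolding D_def[symmetric] by eventually_elim (use that in \<open>auto intro!: D_mono I\<close>)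
    qed simp
  qed
qed

section \<open>The specular derivative as a subgradient\<close>

lemma convex_on_specular_derivative:
  fixes f :: "real \<Rightarrow> real"
  assumes "open I" and "convex_on I f" and x: "x \<in> I"
  obtains s where "has_specular_derivative f s x" and "s \<in> subdifferential I f x"
proof -
  obtain r l where r: "((\<lambda>h. (f (x + h) - f x) / h) \<longlongrightarrow> r) (at_right 0)"
    and l: "((\<lambda>h. (f x - f (x - h)) / h) \<longlongrightarrow> l) (at_right 0)"
    and "l \<le> r"
    and below: "\<And>h. h < 0 \<Longrightarrow> x + h \<in> I \<Longrightarrow> (f (x + h) - f x) / h \<le> l"
    and above: "\<And>h. h > 0 \<Longrightarrow> x + h \<in> I \<Longrightarrow> r \<le> (f (x + h) - f x) / h"
    by (rule convex_on_one_sided_derivatives[OF assms]) blast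
  define s where "s = specular_A r l 1"
  have s: "l \<le> s" "s \<le> r"
    using specular_A_between[OF \<open>l \<le> r\<close>] by (simp_all add: s_def)
  have "f y \<ge> f x + s * (y - x)" if "y \<in> I" for y
  proof -
    consider "y < x" | "y = x" | "x < y"
      by linarith
    then show ?thesis
    proof cases
      case 1
      then have "(f y - f x) / (y - x) \<le> s"
        using below[of "y - x"] that s by simp
      with 1 show ?thesis
        by (simp add: neg_divide_le_eq)
    next
      case 3
      then have "s \<le> (f y - f x) / (y - x)"
        using above[of "y - x"] that s by simp
      with 3 show ?thesis
        by (simp add: pos_le_divide_eq)
    qed simp
  qed
  then have "s \<in> subdifferential I f x"
    by (simp add: subdifferential_def)
  with has_specular_derivative_one_sided[OF r l] show thesis
    using that by (simp add: s_def)
qed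

theorem corollary2p21:
  fixes I :: "real set" and f :: "real \<Rightarrow> real"
  assumes "open I" and "is_interval I"
    and "convex_on I f"
  shows "f \<in> S1 I
    \<and> (\<forall>x\<in>I. specular_deriv f x \<in> subdifferential I f x)
    \<and> (\<forall>x\<in>I. \<forall>y\<in>I. f y \<ge> f x + specular_deriv f x * (y - x))"
proof -
  have key: "specularly_differentiable f x \<and> specular_deriv f x \<in> subdifferential I f x"
    if x: "x \<in> I" for x
  proof -
    obtain s where "has_specular_derivative f s x" "s \<in> subdifferential I f x"
      using convex_on_specular_derivative[OF assms(1,3) x] .
    then show ?thesis
      by (auto simp: specularly_differentiable_def specular_deriv_eqI)
  qed
  moreover have "continuous_on I f"
    using assms(1,3) by (rule convex_on_continuous)
  ultimately have "f \<in> S1 I"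
    by (simp add: S1_def C0_def S0_def)
  with key show ?thesis
    by (auto simp: subdifferential_def)
qed

end
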